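(* Let $J:(0,\infty)\to[0,\infty)$ satisfy: (1) $J(1)=0$; (2) $J(x)=J(x^{-1})$ for all $x>0$; (3) $J$ is strictly convex on $(0,\infty)$; (4) for all $x,y>0$, $J(xy)+J(x/y)=2J(x)+2J(y)+2J(x)J(y)$. Define $C:(0,\infty)\to\mathbb{R}$ by $C(x):=1+J(x)$ and $f:\mathbb{R}\to\mathbb{R}$ by $f(u):=C(e^{u})$. Then $f$ is continuous, satisfies $$f(u+v)+f(u-v)=2f(u)f(v)\qquad\text{for all }u,v\in\mathbb{R},$$ and $f(0)=1$. *)

theory Defs
  imports "HOL-Analysis.Analysis"
begin

text \<open>The library only provides the non-strict notion \<^const>\<open>convex_on\<close>; this is its strict variant.\<close>

definition strictly_convex_on :: "'a::real_vector set \<Rightarrow> ('a \<Rightarrow> real) \<Rightarrow> bool" where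
  "strictly_convex_on S f \<longleftrightarrow> convex S \<and>
     (\<forall>x\<in>S. \<forall>y\<in>S. x \<noteq> y \<longrightarrow>
        (\<forall>t. 0 < t \<and> t < 1 \<longrightarrow>
           f ((1 - t) *\<^sub>R x + t *\<^sub>R y) < (1 - t) * f x + t * f y))"

end

theory Submission
  imports Defs
begin

text \<open>Adding 1 to \<open>J\<close> completes a product: 2 + 2a + 2b + 2ab = 2(1 + a)(1 + b),
  so \<open>J_mult\<close> becomes d'Alembert's equation for \<open>C\<close> in multiplicative
  form, and \<open>exp\<close> turns products and quotients into sums and differences. Continuity
  comes from convexity, through this lemma.\<close>

lemma strictly_convex_on_imp_convex_on:
  assumes "strictly_convex_on S f"
  shows "convex_on S f"
proof (rule convex_onI)
  fix t x y
  assume t: "0 < t" "t < (1::real)" and xy: "x \<in> S" "y \<in> S"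
  show "f ((1 - t) *\<^sub>R x + t *\<^sub>R y) \<le> (1 - t) * f x + t * f y"
  \<comment> \<open>Strictness is postulated for distinct points only; at equal points both sides
    are \<open>f x\<close>.\<close>
  proof (cases "x = y")
    case True
    then show ?thesis
      by (simp add: algebra_simps)
  next
    case False
    then show ?thesis
      using assms t xy unfolding strictly_convex_on_def by (meson less_imp_le)
  qed
qed (use assms in \<open>simp add: strictly_convex_on_def\<close>)

theorem lemmaA2:
  fixes J C f :: "real \<Rightarrow> real"
  assumes J_nonneg: "\<And>x. 0 < x \<Longrightarrow> 0 \<le> J x"
    and J_one: "J 1 = 0"
    and J_inverse: "\<And>x. 0 < x \<Longrightarrow> J x = J (inverse x)"
    and J_strictly_convex: "strictly_convex_on {0<..} J"
    and J_mult: "\<And>x y. 0 < x \<Longrightarrow> 0 < y \<Longrightarrow>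
      J (x * y) + J (x / y) = 2 * J x + 2 * J y + 2 * J x * J y"
    and C_def: "\<And>x. 0 < x \<Longrightarrow> C x = 1 + J x"
    and f_def: "\<And>u. f u = C (exp u)"
  shows "continuous_on UNIV f \<and>
    (\<forall>u v. f (u + v) + f (u - v) = 2 * f u * f v) \<and>
    f 0 = 1"
proof (intro conjI allI)
  have f_eq: "f u = 1 + J (exp u)" for u
    by (simp add: f_def C_def)
  \<comment> \<open>A convex function is continuous on an open convex set of finite dimension; at an
    included endpoint it could jump.\<close>
  have "continuous_on {0<..} J"
    by (intro convex_on_continuous strictly_convex_on_imp_convex_on J_strictly_convex open_greaterThan)
  then have "continuous_on UNIV (\<lambda>u. J (exp u))"
    by (rule continuous_on_compose2) (auto intro: continuous_intros)
  then show "continuous_on UNIV f"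
    unfolding f_eq by (intro continuous_intros)
  show "f (u + v) + f (u - v) = 2 * f u * f v" for u v
    \<comment> \<open>With x = \<open>exp u\<close> and y = \<open>exp v\<close>, xy and x/y are the
      exponentials of u + v and u - v.\<close>
    using J_mult[of "exp u" "exp v"] by (simp add: f_eq exp_add exp_diff algebra_simps)
  show "f 0 = 1"
    by (simp add: f_eq J_one)
qed

end
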